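(* Let $\Lambda$ be a discretely ordered abelian group, $X$ a set, and $G$ a subgroup of $CDR(\Lambda,X)$. Let $\Gamma_G = S_G/\sim$ be the set obtained from $S_G=\{(\alpha,g)\mid g\in G,\ \alpha\in[0,|g|]\}$ by the equivalence relation $(\alpha,f)\sim(\beta,g)\iff \alpha=\beta\in[0,c(f,g)]$, and let $\langle\alpha,f\rangle$ denote the class of $(\alpha,f)$. Then $\Gamma_G$, equipped with $$d(\langle \alpha, f \rangle, \langle \beta, g \rangle) = \alpha + \beta - 2\min\{\alpha, \beta, c(f,g)\},$$ is a $\Lambda$-tree.
   Context: $\Lambda$ is a (linearly) ordered abelian group, discretely ordered: it has a minimal positive element, denoted $1$. For $a,b\in\Lambda$, $[a,b]=\{c\in\Lambda\mid a\le c\le b\}$. Infinite words. For a set $X$ put $X^{\pm}=X\cup X^{-1}$ (formal inverses, $(x^{-1})^{-1}=x$). A $\Lambda$-word is a function $w:[1,\alpha_w]\to X^{\pm}$ with $\alpha_w\in\Lambda$, $\alpha_w\ge 0$; $|w|=\alpha_w$ is its length; $\varepsilon$ is the empty word. The concatenation $uv$ has length $|u|+|v|$, with $(uv)(a)=u(a)$ for $1\le a\le|u|$ and $(uv)(a)=v(a-|u|)$ for $|u|<a\le|u|+|v|$. The inverse $w^{-1}$ has length $|w|$ and $w^{-1}(\beta)=w(|w|+1-\beta)^{-1}$. The word $w$ is reduced if $w(\beta+1)\ne w(\beta)^{-1}$ for all $1\le\beta<|w|$; $R(\Lambda,X)$ is the set of reduced $\Lambda$-words. Write $uv=u\circ v$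 if $u,v$ and $uv$ are reduced. For $u,v\in R(\Lambda,X)$, $\mathrm{com}(u,v)$ is the longest common initial segment of $u$ and $v$, if it exists: $u=\mathrm{com}(u,v)\circ\tilde u$, $v=\mathrm{com}(u,v)\circ\tilde v$, where $\tilde u,\tilde v$ do not begin with the same letter (either may be empty). If $\mathrm{com}(u^{-1},v)$ is defined, with $u^{-1}=\mathrm{com}(u^{-1},v)\circ\tilde u$ and $v=\mathrm{com}(u^{-1},v)\circ\tilde v$, put $u*v=\tilde u^{-1}\circ\tilde v$; this is a partial operation on $R(\Lambda,X)$. A (nonempty) word $v\in R(\Lambda,X)$ is cyclically reduced if $v(1)^{-1}\ne v(|v|)$; $CDR(\Lambda,X)$ is the set of reduced words $v$ admitting a cyclic decomposition $v=c^{-1}\circ u\circ c$ with $c,u\in R(\Lambda,X)$ and $u$ cyclically reduced, together with the empty word. A subgroup $G$ of $CDR(\Lambda,X)$ is a subset containing $\varepsilon$ (the identity $1$ of $G$), closed under inversion, on which $*$ is everywhere defined with values in $G$ and which is a group under $*$. For $f,g\in G$ the word $\mathrm{com}(f,g)$ is then defined, and $c(f,g)=\frac12(|f|+|g|-|f^{-1}*g|)=|\mathrm{com}(f,g)|\in\Lambda$. The restriction of the length $|\cdot|$ to $G$ is a Lyndon length function. $\Lambda$-trees. A $\Lambda$-metric space is a nonempty set with a $\Lambda$-valued metric (usual axioms). A segment is the image of a distance-preserving map $\alpha:[a,b]\to X$ with $[a,b]\subset\Lambda$ (with metric $|x-y|$); its endpoints are $\alpha(a),\alpha(b)$. A $\Lambda$-tree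 is a $\Lambda$-metric space such that (T1) any two points are the endpoints of some segment; (T2) if two segments intersect in a single point which is an endpoint of both, their union is a segment; (T3) the intersection of two segments with a common endpoint is a segment. *)

theory Defs
  imports "HOL-Algebra.Group"
begin

section \<open>Discretely ordered abelian groups\<close>

text \<open>
  The absolute value is a class parameter, but the order determines it.
\<close>

class discrete_linordered_ab_group_add =
  linordered_ab_group_add + ordered_ab_group_add_abs + zero_less_one +
  assumes one_le_if_pos: "0 < x \<Longrightarrow> 1 \<le> x"


section \<open>Infinite words\<close>

datatype 'x letter = Gen 'x | Inv 'x

fun letter_inv :: "'x letter \<Rightarrow> 'x letter" where
  "letter_inv (Gen x) = Inv x"
| "letter_inv (Inv x) = Gen x"

definition letters :: "'x set \<Rightarrow> 'x letter set" where
  "letters X = Gen ` X \<union> Inv ` X"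

text \<open>
  A word of length \<open>\<alpha>\<close> carries a total function that is \<open>undefined\<close> outside \<open>{1..\<alpha>}\<close>,
  so that words are equal iff they have the same length and the same letters.
\<close>

datatype ('l, 'x) lword = LWord (len: 'l) (at: "'l \<Rightarrow> 'x letter")

definition lwords :: "'x set \<Rightarrow> ('l::discrete_linordered_ab_group_add, 'x) lword set" where
  "lwords X = {w. 0 \<le> len w \<and> at w \<in> {1..len w} \<rightarrow>\<^sub>E letters X}"

definition empty_word :: "('l::discrete_linordered_ab_group_add, 'x) lword" where
  "empty_word = LWord 0 (\<lambda>_. undefined)"

definition concat_word ::
  "('l::discrete_linordered_ab_group_add, 'x) lword \<Rightarrow> ('l, 'x) lword \<Rightarrow> ('l, 'x) lword"
  (infixl "\<cdot>\<^sub>w" 70) where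
  "u \<cdot>\<^sub>w v = LWord (len u + len v)
     (\<lambda>a\<in>{1..len u + len v}. if a \<le> len u then at u a else at v (a - len u))"

definition inv_word ::
  "('l::discrete_linordered_ab_group_add, 'x) lword \<Rightarrow> ('l, 'x) lword" where
  "inv_word w = LWord (len w) (\<lambda>b\<in>{1..len w}. letter_inv (at w (len w + 1 - b)))"

definition reduced_words :: "'x set \<Rightarrow> ('l::discrete_linordered_ab_group_add, 'x) lword set" where
  "reduced_words X =
     {w \<in> lwords X. \<forall>b. 1 \<le> b \<and> b < len w \<longrightarrow> at w (b + 1) \<noteq> letter_inv (at w b)}"

text \<open>\<open>circ_eq X w u v\<close> expresses \<open>w = u \<circ> v\<close>.\<close>

definition circ_eq :: "'x set \<Rightarrow> ('l::discrete_linordered_ab_group_add, 'x) lword \<Rightarrow>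
    ('l, 'x) lword \<Rightarrow> ('l, 'x) lword \<Rightarrow> bool" where
  "circ_eq X w u v \<longleftrightarrow>
     u \<in> reduced_words X \<and> v \<in> reduced_words X \<and> u \<cdot>\<^sub>w v \<in> reduced_words X \<and> w = u \<cdot>\<^sub>w v"

text \<open>
  \<open>com_decomp X u v c u' v'\<close> expresses that \<open>c\<close> is the longest common initial segment of
  \<open>u\<close> and \<open>v\<close>, with remainders \<open>u'\<close> and \<open>v'\<close>.
\<close>

definition com_decomp :: "'x set \<Rightarrow> ('l::discrete_linordered_ab_group_add, 'x) lword \<Rightarrow>
    ('l, 'x) lword \<Rightarrow> ('l, 'x) lword \<Rightarrow> ('l, 'x) lword \<Rightarrow> ('l, 'x) lword \<Rightarrow> bool" where
  "com_decomp X u v c u' v' \<longleftrightarrow> circ_eq X u c u' \<and> circ_eq X v c v' \<and>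
     \<not> (0 < len u' \<and> 0 < len v' \<and> at u' 1 = at v' 1)"

text \<open>
  The partial product \<open>u * v\<close>: it is defined iff \<open>com (u\<inverse>, v)\<close> is, and \<open>star X u v\<close> is its value
  in that case (unspecified otherwise).
\<close>

definition star_defined :: "'x set \<Rightarrow> ('l::discrete_linordered_ab_group_add, 'x) lword \<Rightarrow>
    ('l, 'x) lword \<Rightarrow> bool" where
  "star_defined X u v \<longleftrightarrow> (\<exists>c u' v'. com_decomp X (inv_word u) v c u' v')"

definition star :: "'x set \<Rightarrow> ('l::discrete_linordered_ab_group_add, 'x) lword \<Rightarrow>
    ('l, 'x) lword \<Rightarrow> ('l, 'x) lword" where
  "star X u v =
     (THE w. \<exists>c u' v'. com_decomp X (inv_word u) v c u' v' \<and> circ_eq X w (inv_word u') v')"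

definition cyclically_reduced :: "'x set \<Rightarrow> ('l::discrete_linordered_ab_group_add, 'x) lword \<Rightarrow> bool"
  where
  "cyclically_reduced X v \<longleftrightarrow>
     v \<in> reduced_words X \<and> v \<noteq> empty_word \<and> letter_inv (at v 1) \<noteq> at v (len v)"

definition CDR :: "'x set \<Rightarrow> ('l::discrete_linordered_ab_group_add, 'x) lword set" where
  "CDR X = insert empty_word
     {v \<in> reduced_words X. \<exists>c u p. c \<in> reduced_words X \<and> cyclically_reduced X u \<and>
        circ_eq X p (inv_word c) u \<and> circ_eq X v p c}"

definition CDR_subgroup :: "'x set \<Rightarrow> ('l::discrete_linordered_ab_group_add, 'x) lword set \<Rightarrow> bool"
  where
  "CDR_subgroup X G \<longleftrightarrow> G \<subseteq> CDR X \<and> empty_word \<in> G \<and> (\<forall>f\<in>G. inv_word f \<in> G) \<and>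
     (\<forall>f\<in>G. \<forall>g\<in>G. star_defined X f g \<and> star X f g \<in> G) \<and>
     group \<lparr>carrier = G, mult = star X, one = empty_word\<rparr>"

text \<open>
  \<open>c(f,g) = (|f| + |g| - |f\<inverse> * g|) / 2\<close>; halves are unique in an ordered group.
\<close>

definition cprod :: "'x set \<Rightarrow> ('l::discrete_linordered_ab_group_add, 'x) lword \<Rightarrow>
    ('l, 'x) lword \<Rightarrow> 'l" where
  "cprod X f g = (THE c. c + c = len f + len g - len (star X (inv_word f) g))"


section \<open>\<open>\<Lambda>\<close>-trees\<close>

definition lambda_metric ::
  "'p set \<Rightarrow> ('p \<Rightarrow> 'p \<Rightarrow> 'l::discrete_linordered_ab_group_add) \<Rightarrow> bool" where
  "lambda_metric M d \<longleftrightarrow> M \<noteq> {} \<and>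
     (\<forall>x\<in>M. \<forall>y\<in>M. 0 \<le> d x y \<and> (d x y = 0 \<longleftrightarrow> x = y) \<and> d x y = d y x) \<and>
     (\<forall>x\<in>M. \<forall>y\<in>M. \<forall>z\<in>M. d x z \<le> d x y + d y z)"

text \<open>\<open>segment M d s E\<close>: \<open>s\<close> is a segment and \<open>E\<close> is the set of its endpoints.\<close>

definition segment ::
  "'p set \<Rightarrow> ('p \<Rightarrow> 'p \<Rightarrow> 'l::discrete_linordered_ab_group_add) \<Rightarrow> 'p set \<Rightarrow> 'p set \<Rightarrow> bool" where
  "segment M d s E \<longleftrightarrow> (\<exists>a b \<phi>. a \<le> b \<and> \<phi> \<in> {a..b} \<rightarrow> M \<and>
     (\<forall>x\<in>{a..b}. \<forall>y\<in>{a..b}. d (\<phi> x) (\<phi> y) = \<bar>x - y\<bar>) \<and>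
     s = \<phi> ` {a..b} \<and> E = {\<phi> a, \<phi> b})"

definition lambda_tree ::
  "'p set \<Rightarrow> ('p \<Rightarrow> 'p \<Rightarrow> 'l::discrete_linordered_ab_group_add) \<Rightarrow> bool" where
  "lambda_tree M d \<longleftrightarrow> lambda_metric M d \<and>
     (\<forall>x\<in>M. \<forall>y\<in>M. \<exists>s. segment M d s {x, y}) \<and>
     (\<forall>s t E F p. segment M d s E \<and> segment M d t F \<and> s \<inter> t = {p} \<and> p \<in> E \<and> p \<in> F
        \<longrightarrow> (\<exists>D. segment M d (s \<union> t) D)) \<and>
     (\<forall>s t E F p. segment M d s E \<and> segment M d t F \<and> p \<in> E \<and> p \<in> F
        \<longrightarrow> (\<exists>D. segment M d (s \<inter> t) D))"


section \<open>The space \<open>\<Gamma>\<^sub>G\<close>\<close>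

definition S_set :: "('l::discrete_linordered_ab_group_add, 'x) lword set \<Rightarrow>
    ('l \<times> ('l, 'x) lword) set" where
  "S_set G = {(\<alpha>, g). g \<in> G \<and> \<alpha> \<in> {0..len g}}"

definition S_rel :: "'x set \<Rightarrow> ('l::discrete_linordered_ab_group_add, 'x) lword set \<Rightarrow>
    (('l \<times> ('l, 'x) lword) \<times> ('l \<times> ('l, 'x) lword)) set" where
  "S_rel X G = {((\<alpha>, f), (\<beta>, g)). (\<alpha>, f) \<in> S_set G \<and> (\<beta>, g) \<in> S_set G \<and>
     \<alpha> = \<beta> \<and> \<alpha> \<in> {0..cprod X f g}}"

definition Gamma :: "'x set \<Rightarrow> ('l::discrete_linordered_ab_group_add, 'x) lword set \<Rightarrow>
    ('l \<times> ('l, 'x) lword) set set" where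
  "Gamma X G = S_set G // S_rel X G"

definition Gamma_pt :: "'x set \<Rightarrow> ('l::discrete_linordered_ab_group_add, 'x) lword set \<Rightarrow>
    'l \<Rightarrow> ('l, 'x) lword \<Rightarrow> ('l \<times> ('l, 'x) lword) set" where
  "Gamma_pt X G \<alpha> f = S_rel X G `` {(\<alpha>, f)}"

definition Gamma_dist_rep :: "'x set \<Rightarrow> 'l::discrete_linordered_ab_group_add \<Rightarrow>
    ('l, 'x) lword \<Rightarrow> 'l \<Rightarrow> ('l, 'x) lword \<Rightarrow> 'l" where
  "Gamma_dist_rep X \<alpha> f \<beta> g =
     (let m = min (min \<alpha> \<beta>) (cprod X f g) in \<alpha> + \<beta> - (m + m))"

text \<open>
  The metric on classes is the common value of the formula on all pairs of representatives;
  that the value does not depend on the representatives is not built into this definition.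
\<close>

definition Gamma_dist :: "'x set \<Rightarrow> ('l::discrete_linordered_ab_group_add \<times> ('l, 'x) lword) set \<Rightarrow>
    ('l \<times> ('l, 'x) lword) set \<Rightarrow> 'l" where
  "Gamma_dist X P Q =
     (THE r. \<forall>(\<alpha>, f)\<in>P. \<forall>(\<beta>, g)\<in>Q. r = Gamma_dist_rep X \<alpha> f \<beta> g)"

end

theory Submission
  imports Defs
begin

text \<open>
  Maximality of \<open>com(f, g)\<close>, together with discreteness of the order, shows that \<open>f\<close> and \<open>g\<close> agree on
  \<open>{1..\<alpha>}\<close> iff \<open>\<alpha> \<le> c(f, g)\<close>. Hence \<open>\<langle>\<alpha>, f\<rangle>\<close> is the initial segment of \<open>f\<close> of length \<open>\<alpha>\<close>, and the
  length \<open>m(P, Q)\<close> of the common part of two such prefixes satisfies the ultrametric inequality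
  \<open>min (m(P, Q)) (m(Q, R)) \<le> m(P, R)\<close>. This makes \<open>d(P, Q) = |P| + |Q| - 2 m(P, Q)\<close> a metric, in
  which a geodesic descends from \<open>P\<close> to the meet of \<open>P\<close> and \<open>Q\<close> and then ascends to \<open>Q\<close>, points between
  \<open>P\<close> and \<open>Q\<close> are determined by their distance from \<open>P\<close>, and three points have a median, namely
  the highest of the three pairwise meets. If \<open>c\<close> is the median of \<open>p, x, y\<close>, then
  \<open>[p, x] \<inter> [p, y] = [p, c]\<close>, which is (T3); if moreover \<open>c = p\<close>, then
  \<open>[p, x] \<union> [p, y] = [x, y]\<close>, which is (T2).
\<close>

section \<open>Arithmetic in ordered and discretely ordered abelian groups\<close>

lemma double_inject:
  fixes a b :: "'l::linordered_ab_group_add"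
  assumes "a + a = b + b"
  shows "a = b"
  using assms add_strict_mono[of a b a b] add_strict_mono[of b a b a]
  by (metis linorder_neqE less_irrefl)

lemma add_one_le_if_less:
  fixes a b :: "'l::discrete_linordered_ab_group_add"
  assumes "a < b"
  shows "a + 1 \<le> b"
  using one_le_if_pos[of "b - a"] assms by (simp add: le_diff_eq add.commute)

lemma less_add_one_discrete:
  fixes a :: "'l::discrete_linordered_ab_group_add"
  shows "a < a + 1"
  using zero_less_one[where 'a='l] by simp

lemma one_le_add_one:
  fixes a :: "'l::discrete_linordered_ab_group_add"
  assumes "0 \<le> a"
  shows "1 \<le> a + 1"
  using assms by simp


section \<open>Words and common prefixes\<close>

lemma lword_eqI:
  fixes u v :: "('l::discrete_linordered_ab_group_add, 'x) lword"
  assumes "u \<in> lwords X" "v \<in> lwords X" "len u = len v"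
    and "\<And>i. \<lbrakk>1 \<le> i; i \<le> len u\<rbrakk> \<Longrightarrow> at u i = at v i"
  shows "u = v"
proof -
  have "at u = at v"
    by (rule PiE_ext[of _ "{1..len u}" "\<lambda>_. letters X"]) (use assms in \<open>auto simp: lwords_def\<close>)
  with assms(3) show ?thesis by (simp add: lword.expand)
qed

lemma len_nonneg: "u \<in> lwords X \<Longrightarrow> 0 \<le> len u"
  by (simp add: lwords_def)

lemma at_in_letters: "\<lbrakk>u \<in> lwords X; 1 \<le> i; i \<le> len u\<rbrakk> \<Longrightarrow> at u i \<in> letters X"
  by (auto simp: lwords_def)

lemma reduced_words_subset_lwords: "u \<in> reduced_words X \<Longrightarrow> u \<in> lwords X"
  by (simp add: reduced_words_def)

lemma len_concat_word [simp]: "len (u \<cdot>\<^sub>w v) = len u + len v"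
  by (simp add: concat_word_def)

lemma at_concat_word_left:
  assumes "v \<in> lwords X" "1 \<le> i" "i \<le> len u"
  shows "at (u \<cdot>\<^sub>w v) i = at u i"
  using assms len_nonneg[OF assms(1)] by (simp add: concat_word_def add_increasing2)

lemma at_concat_word_right:
  assumes "u \<in> lwords X" "1 \<le> i" "i \<le> len v"
  shows "at (u \<cdot>\<^sub>w v) (len u + i) = at v i"
proof -
  have "\<not> i \<le> 0" using assms(2) less_le_trans[OF zero_less_one, of i] by (simp add: not_le)
  moreover have "1 \<le> len u + i"
    using assms len_nonneg[OF assms(1)] by (simp add: add_increasing)
  ultimately show ?thesis using assms by (simp add: concat_word_def)
qed

lemma concat_word_in_lwords:
  assumes "u \<in> lwords X" "v \<in> lwords X"
  shows "u \<cdot>\<^sub>w v \<in> lwords X"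
proof -
  have "(if a \<le> len u then at u a else at v (a - len u)) \<in> letters X"
    if "1 \<le> a" "a \<le> len u + len v" for a
  proof (cases "a \<le> len u")
    case False
    then have "1 \<le> a - len u" by (simp add: one_le_if_pos)
    with False that show ?thesis
      using at_in_letters[OF assms(2), of "a - len u"] by (simp add: diff_le_eq add.commute)
  qed (use that assms at_in_letters in auto)
  then show ?thesis
    using assms by (auto simp: lwords_def concat_word_def)
qed

lemma concat_word_cancel:
  assumes "u \<in> lwords X" "v \<in> lwords X" "u' \<in> lwords X" "v' \<in> lwords X"
    and eq: "u \<cdot>\<^sub>w v = u' \<cdot>\<^sub>w v'" and len: "len u = len u'"
  shows "u = u'" "v = v'"
proof -
  show "u = u'"
    by (rule lword_eqI[OF assms(1,3) len]) (metis assms at_concat_word_left)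
  have "len v = len v'"
    using arg_cong[OF eq, of len] len by simp
  then show "v = v'"
    by (rule lword_eqI[OF assms(2,4)]) (metis assms at_concat_word_right \<open>len v = len v'\<close>)
qed

section \<open>Inverse words and reducedness\<close>

lemma letter_inv_letter_inv [simp]: "letter_inv (letter_inv a) = a"
  by (cases a) auto

lemma letter_inv_in_letters: "a \<in> letters X \<Longrightarrow> letter_inv a \<in> letters X"
  by (auto simp: letters_def)

lemma len_inv_word [simp]: "len (inv_word w) = len w"
  by (simp add: inv_word_def)

lemma at_inv_word:
  "\<lbrakk>1 \<le> i; i \<le> len w\<rbrakk> \<Longrightarrow> at (inv_word w) i = letter_inv (at w (len w + 1 - i))"
  by (simp add: inv_word_def)

lemma mirror_bounds:
  fixes n i :: "'l::discrete_linordered_ab_group_add"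
  assumes "1 \<le> i" "i \<le> n"
  shows "1 \<le> n + 1 - i" "n + 1 - i \<le> n"
  using assms by (simp_all add: le_diff_eq diff_le_eq add.commute add_mono)

lemma inv_word_in_lwords:
  assumes "w \<in> lwords X"
  shows "inv_word w \<in> lwords X"
  using assms at_in_letters[OF assms mirror_bounds] letter_inv_in_letters
  by (fastforce simp: lwords_def inv_word_def)

lemma inv_word_inv_word:
  assumes "w \<in> lwords X"
  shows "inv_word (inv_word w) = w"
  by (rule lword_eqI[of _ X])
    (use assms mirror_bounds in \<open>auto simp: inv_word_in_lwords at_inv_word\<close>)

text \<open>With n = \<open>len w\<close>, the neighbours b, b + 1 of the inverse come from the
  neighbours n + 1 - b, n - b of \<open>w\<close> in opposite order, and the condition excluding a
  cancelling pair is symmetric in its two letters.\<close>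

lemma inv_word_reduced:
  assumes "w \<in> reduced_words X"
  shows "inv_word w \<in> reduced_words X"
proof -
  have w: "w \<in> lwords X" using assms reduced_words_subset_lwords by blast
  have "at (inv_word w) (b + 1) \<noteq> letter_inv (at (inv_word w) b)"
    if b: "1 \<le> b" "b < len w" for b
  proof -
    have "b + 1 \<le> len w" "1 \<le> b + 1"
      using add_one_le_if_less[OF b(2)] order_trans[OF b(1) less_imp_le[OF less_add_one_discrete]]
      by simp_all
    then have 1: "at (inv_word w) (b + 1) = letter_inv (at w (len w - b))"
      by (simp add: at_inv_word)
    have 2: "at (inv_word w) b = letter_inv (at w (len w - b + 1))"
      using b by (simp add: at_inv_word algebra_simps)
    have "1 \<le> len w - b" "len w - b < len w"
      using b \<open>b + 1 \<le> len w\<close> less_le_trans[OF zero_less_one b(1)]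
      by (auto simp: one_le_if_pos)
    then have "at w (len w - b + 1) \<noteq> letter_inv (at w (len w - b))"
      using assms unfolding reduced_words_def by blast
    with 1 2 show ?thesis by auto
  qed
  with inv_word_in_lwords[OF w] show ?thesis by (simp add: reduced_words_def)
qed

text \<open>The only pair of neighbours that lies neither in \<open>u\<close> nor in
  \<open>v\<close> is the one at the junction, and it exists only if both words are
  nonempty.\<close>

lemma concat_word_reduced:
  assumes u: "u \<in> reduced_words X" and v: "v \<in> reduced_words X"
    and junction: "\<lbrakk>0 < len u; 0 < len v\<rbrakk> \<Longrightarrow> at v 1 \<noteq> letter_inv (at u (len u))"
  shows "u \<cdot>\<^sub>w v \<in> reduced_words X"
proof -
  have lw: "u \<in> lwords X" "v \<in> lwords X"
    using u v reduced_words_subset_lwords by blast+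
  have "at (u \<cdot>\<^sub>w v) (b + 1) \<noteq> letter_inv (at (u \<cdot>\<^sub>w v) b)"
    if b: "1 \<le> b" "b < len u + len v" for b
  proof -
    have b1: "1 \<le> b + 1"
      using b less_add_one_discrete[of b] by (meson less_imp_le order_trans)
    have b0: "0 < b" using b less_le_trans[OF zero_less_one] by blast
    consider "b < len u" | "b = len u" | "len u < b" by force
    then show ?thesis
    proof cases
      case 1
      then show ?thesis
        using u b b1 add_one_le_if_less[OF 1]
        by (simp add: at_concat_word_left[OF lw(2)] reduced_words_def)
    next
      case 2
      then have "0 < len v" using b by simp
      then have "1 \<le> len v" by (rule one_le_if_pos)
      then have "at (u \<cdot>\<^sub>w v) (b + 1) = at v 1"
        using 2 at_concat_word_right[OF lw(1), of 1 v] by simp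
      then show ?thesis
        using 2 b b0 junction \<open>0 < len v\<close> by (simp add: at_concat_word_left[OF lw(2)])
    next
      case 3
      define i where "i = b - len u"
      have i: "b = len u + i" "1 \<le> i" "i < len v"
        using 3 b by (auto simp: i_def one_le_if_pos less_diff_eq diff_less_eq add.commute)
      have "1 \<le> i + 1"
        using i less_add_one_discrete[of i] by (meson less_imp_le order_trans)
      then have "at (u \<cdot>\<^sub>w v) (b + 1) = at v (i + 1)"
        using i add_one_le_if_less[OF i(3)] at_concat_word_right[OF lw(1), of "i + 1" v]
        by (simp add: add.assoc)
      moreover have "at (u \<cdot>\<^sub>w v) b = at v i"
        using i at_concat_word_right[OF lw(1), of i v] by simp
      ultimately show ?thesis using v i by (simp add: reduced_words_def)
    qed
  qed
  with concat_word_in_lwords[OF lw] show ?thesis by (simp add: reduced_words_def)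
qed

text \<open>The bounds by both lengths are essential: beyond their ends all words take the same
  value \<open>undefined\<close>, so equality of letters alone would persist there.\<close>

definition agree_upto ::
  "('l::discrete_linordered_ab_group_add, 'x) lword \<Rightarrow> ('l, 'x) lword \<Rightarrow> 'l \<Rightarrow> bool"
  where "agree_upto f g a \<longleftrightarrow> 0 \<le> a \<and> a \<le> len f \<and> a \<le> len g \<and> (\<forall>i\<in>{1..a}. at f i = at g i)"

lemma agree_upto_refl: "agree_upto f f a \<longleftrightarrow> 0 \<le> a \<and> a \<le> len f"
  by (auto simp: agree_upto_def)

lemma agree_upto_sym: "agree_upto f g a \<longleftrightarrow> agree_upto g f a"
  by (auto simp: agree_upto_def)

lemma agree_upto_trans: "\<lbrakk>agree_upto f g a; agree_upto g h a\<rbrakk> \<Longrightarrow> agree_upto f h a"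
  by (auto simp: agree_upto_def)

lemma agree_upto_mono: "\<lbrakk>agree_upto f g b; 0 \<le> a; a \<le> b\<rbrakk> \<Longrightarrow> agree_upto f g a"
  by (auto simp: agree_upto_def)

text \<open>By discreteness, agreement beyond \<open>len c\<close> reaches position
  \<open>len c + 1\<close>. Then both remainders are nonempty and begin with the same letter,
  against the maximality of \<open>c\<close>.\<close>

lemma com_decomp_agree_upto_iff:
  assumes "com_decomp X f g c u v"
  shows "agree_upto f g a \<longleftrightarrow> 0 \<le> a \<and> a \<le> len c"
proof -
  have lw: "c \<in> lwords X" "u \<in> lwords X" "v \<in> lwords X"
    and f: "f = c \<cdot>\<^sub>w u" and g: "g = c \<cdot>\<^sub>w v"
    and max: "\<not> (0 < len u \<and> 0 < len v \<and> at u 1 = at v 1)"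
    using assms reduced_words_subset_lwords by (auto simp: com_decomp_def circ_eq_def)
  note nn = lw[THEN len_nonneg]
  show ?thesis
  proof
    assume a: "agree_upto f g a"
    have "a \<le> len c"
    proof (rule ccontr)
      assume "\<not> a \<le> len c"
      then have "len c < a" by simp
      then have c1: "len c + 1 \<le> a" by (rule add_one_le_if_less)
      have le: "a \<le> len c + len u" "a \<le> len c + len v"
        using a f g by (auto simp: agree_upto_def)
      then have pos: "0 < len u" "0 < len v"
        using \<open>len c < a\<close> by (metis less_le_trans less_add_same_cancel1)+
      have "at f (len c + 1) = at g (len c + 1)"
        using a c1 one_le_add_one[OF nn(1)] by (simp add: agree_upto_def)
      then have "at u 1 = at v 1"
        using at_concat_word_right[OF lw(1) order_refl one_le_if_pos[OF pos(1)]]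
          at_concat_word_right[OF lw(1) order_refl one_le_if_pos[OF pos(2)]]
        by (simp add: f g)
      with max pos show False by simp
    qed
    with a show "0 \<le> a \<and> a \<le> len c" by (simp add: agree_upto_def)
  next
    assume a: "0 \<le> a \<and> a \<le> len c"
    then show "agree_upto f g a"
      using nn by (auto simp: agree_upto_def f g at_concat_word_left[OF lw(2)]
          at_concat_word_left[OF lw(3)] add_increasing2)
  qed
qed

text \<open>The range of agreement does not mention the decomposition, so it fixes
  \<open>len c\<close>; cancellation then fixes the three words. The description in
  \<open>star\<close> rests on this.\<close>

lemma com_decomp_unique:
  assumes "com_decomp X f g c u v" "com_decomp X f g c' u' v'"
  shows "c = c'" "u = u'" "v = v'"
proof -
  have lw: "c \<in> lwords X" "u \<in> lwords X" "v \<in> lwords X"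
      "c' \<in> lwords X" "u' \<in> lwords X" "v' \<in> lwords X"
    and eq: "c \<cdot>\<^sub>w u = c' \<cdot>\<^sub>w u'" "c \<cdot>\<^sub>w v = c' \<cdot>\<^sub>w v'"
    using assms reduced_words_subset_lwords by (auto simp: com_decomp_def circ_eq_def)
  have "len c = len c'"
    using com_decomp_agree_upto_iff[OF assms(1)] com_decomp_agree_upto_iff[OF assms(2)]
      len_nonneg[OF lw(1)] len_nonneg[OF lw(4)] by (meson antisym order_refl)
  then show "c = c'" "u = u'" "v = v'"
    using concat_word_cancel[OF lw(1,2,4,5) eq(1)] concat_word_cancel[OF lw(1,3,4,6) eq(2)] by auto
qed

lemma star_eq:
  assumes "com_decomp X (inv_word f) g c u v"
  shows "star X f g = inv_word u \<cdot>\<^sub>w v"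
proof -
  have u: "u \<in> reduced_words X" and v: "v \<in> reduced_words X"
    and max: "\<not> (0 < len u \<and> 0 < len v \<and> at u 1 = at v 1)"
    using assms by (auto simp: com_decomp_def circ_eq_def)
  \<comment> \<open>The last letter of the inverse of \<open>u\<close> is the inverse of the first
    letter of \<open>u\<close>, so maximality of the common segment is exactly the junction
    condition.\<close>
  have "at v 1 \<noteq> letter_inv (at (inv_word u) (len (inv_word u)))"
    if "0 < len (inv_word u)" "0 < len v"
    using that max by (auto simp: at_inv_word one_le_if_pos)
  then have "circ_eq X (inv_word u \<cdot>\<^sub>w v) (inv_word u) v"
    using u v concat_word_reduced[OF inv_word_reduced[OF u] v]
    by (simp add: circ_eq_def inv_word_reduced)
  then have ex: "\<exists>c' u' v'. com_decomp X (inv_word f) g c' u' v' \<and>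
      circ_eq X (inv_word u \<cdot>\<^sub>w v) (inv_word u') v'"
    using assms by blast
  have "w = inv_word u \<cdot>\<^sub>w v"
    if "com_decomp X (inv_word f) g c' u' v'" "circ_eq X w (inv_word u') v'" for w c' u' v'
    using com_decomp_unique(2,3)[OF assms that(1)] that(2) by (simp add: circ_eq_def)
  with ex show ?thesis
    unfolding star_def by (intro the_equality) blast+
qed

lemma CDR_subset_lwords: "CDR X \<subseteq> lwords X"
  by (auto simp: CDR_def reduced_words_def lwords_def empty_word_def PiE_def
      extensional_def zero_less_one not_le)

text \<open>Closure under inversion makes the product of \<open>inv_word f\<close> and
  \<open>g\<close> defined, which supplies com(f, g). The product consists of the two remainders, so
  the halved expression in \<open>cprod\<close> is |com(f, g)|.\<close>

lemma CDR_subgroup_agree_upto_iff: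
  assumes G: "CDR_subgroup X G" and "f \<in> G" "g \<in> G"
  shows "agree_upto f g a \<longleftrightarrow> 0 \<le> a \<and> a \<le> cprod X f g"
proof -
  have f: "f \<in> lwords X" using assms CDR_subset_lwords by (auto simp: CDR_subgroup_def)
  have "star_defined X (inv_word f) g"
    using assms by (simp add: CDR_subgroup_def)
  then obtain c u v where decomp': "com_decomp X (inv_word (inv_word f)) g c u v"
    unfolding star_defined_def by blast
  then have decomp: "com_decomp X f g c u v" by (simp add: inv_word_inv_word[OF f])
  then have "len f = len c + len u" "len g = len c + len v"
    by (auto simp: com_decomp_def circ_eq_def)
  then have len_star: "len f + len g - len (star X (inv_word f) g) = len c + len c"
    using star_eq[OF decomp'] by (simp add: algebra_simps)
  have "cprod X f g = len c"
    unfolding cprod_def len_star by (rule the_equality) (auto intro: double_inject)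
  with com_decomp_agree_upto_iff[OF decomp] show ?thesis by simp
qed


section \<open>Intervals and medians\<close>

text \<open>The metric interval [x, y]. Having no parametrization, it turns unions and intersections
  of segments into statements about distances.\<close>

definition interval ::
  "'p set \<Rightarrow> ('p \<Rightarrow> 'p \<Rightarrow> 'l::discrete_linordered_ab_group_add) \<Rightarrow> 'p \<Rightarrow> 'p \<Rightarrow> 'p set"
  where "interval M d x y = {z \<in> M. d x z + d z y = d x y}"

text \<open>\<open>interval_unique\<close> makes every segment a full interval, and
  \<open>median\<close> supplies the branch point of two segments with a common endpoint.\<close>

locale median_space =
  fixes M :: "'p set" and d :: "'p \<Rightarrow> 'p \<Rightarrow> 'l::discrete_linordered_ab_group_add"
  assumes metric: "lambda_metric M d"
    and geodesic: "\<lbrakk>x \<in> M; y \<in> M\<rbrakk> \<Longrightarrow> \<exists>s. segment M d s {x, y}"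
    and interval_unique: "\<lbrakk>x \<in> M; y \<in> M; z \<in> interval M d x y; w \<in> interval M d x y; d x z = d x w\<rbrakk>
      \<Longrightarrow> z = w"
    and median: "\<lbrakk>x \<in> M; y \<in> M; z \<in> M\<rbrakk>
      \<Longrightarrow> \<exists>c. c \<in> interval M d x y \<and> c \<in> interval M d y z \<and> c \<in> interval M d x z"
begin

section \<open>Segments as intervals\<close>

lemma dist_nonneg: "\<lbrakk>x \<in> M; y \<in> M\<rbrakk> \<Longrightarrow> 0 \<le> d x y"
  and dist_zero_iff: "\<lbrakk>x \<in> M; y \<in> M\<rbrakk> \<Longrightarrow> d x y = 0 \<longleftrightarrow> x = y"
  and dist_sym: "\<lbrakk>x \<in> M; y \<in> M\<rbrakk> \<Longrightarrow> d x y = d y x"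
  and dist_triangle: "\<lbrakk>x \<in> M; y \<in> M; z \<in> M\<rbrakk> \<Longrightarrow> d x z \<le> d x y + d y z"
  using metric unfolding lambda_metric_def by blast+

lemma interval_subset: "z \<in> interval M d x y \<Longrightarrow> z \<in> M"
  by (simp add: interval_def)

lemma interval_sym: "\<lbrakk>x \<in> M; y \<in> M\<rbrakk> \<Longrightarrow> interval M d x y = interval M d y x"
  unfolding interval_def using dist_sym by (auto simp: add.commute)

lemma interval_trans:
  assumes xy: "x \<in> M" "y \<in> M" and c: "c \<in> interval M d x y" and z: "z \<in> interval M d x c"
  shows "z \<in> interval M d x y"
proof -
  have m: "c \<in> M" "z \<in> M" and eq: "d x c + d c y = d x y" "d x z + d z c = d x c"
    using c z by (auto simp: interval_def)
  have "d x z + d z y \<le> d x z + (d z c + d c y)"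
    using dist_triangle[OF m(2) m(1) xy(2)] by simp
  also have "\<dots> = d x y" using eq by (simp add: add.assoc[symmetric])
  finally show ?thesis
    using dist_triangle[OF xy(1) m(2) xy(2)] m by (auto simp: interval_def)
qed

text \<open>An isometric image lies in the interval between its endpoints. Conversely, a point of
  the interval equals the image point at the same distance from \<phi> a, by
  \<open>interval_unique\<close>.\<close>

lemma segment_eq_interval:
  assumes "segment M d s E"
  obtains x y where "x \<in> M" "y \<in> M" "E = {x, y}" "s = interval M d x y"
proof -
  obtain a b \<phi> where ab: "a \<le> b" and \<phi>: "\<phi> \<in> {a..b} \<rightarrow> M"
    and iso: "\<And>t u. \<lbrakk>t \<in> {a..b}; u \<in> {a..b}\<rbrakk> \<Longrightarrow> d (\<phi> t) (\<phi> u) = \<bar>t - u\<bar>"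
    and s: "s = \<phi> ` {a..b}" and E: "E = {\<phi> a, \<phi> b}"
    using assms unfolding segment_def by blast
  have left: "d (\<phi> a) (\<phi> t) = t - a" and right: "d (\<phi> t) (\<phi> b) = b - t" if "t \<in> {a..b}" for t
    using iso[of a t] iso[of t b] that ab by (auto simp: abs_of_nonpos)
  have ends: "\<phi> a \<in> M" "\<phi> b \<in> M" using \<phi> ab by auto
  have dab: "d (\<phi> a) (\<phi> b) = b - a" using left ab by simp
  have sub: "\<phi> t \<in> interval M d (\<phi> a) (\<phi> b)" if "t \<in> {a..b}" for t
    using that \<phi> left[OF that] right[OF that] dab by (auto simp: interval_def)
  have "z \<in> s" if z: "z \<in> interval M d (\<phi> a) (\<phi> b)" for z
  proof -
    define t where "t = a + d (\<phi> a) z"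
    have "z \<in> M" and eq: "d (\<phi> a) z + d z (\<phi> b) = b - a"
      using z dab by (auto simp: interval_def)
    then have "d (\<phi> a) z \<le> b - a"
      using dist_nonneg[OF \<open>z \<in> M\<close> ends(2)] by (metis add_increasing2 order_refl)
    then have t: "t \<in> {a..b}"
      using dist_nonneg[OF ends(1) \<open>z \<in> M\<close>] by (simp add: t_def le_diff_eq add.commute)
    have "z = \<phi> t"
      by (rule interval_unique[OF ends z sub[OF t]]) (simp add: left[OF t], simp add: t_def)
    with t s show ?thesis by blast
  qed
  with sub s have "s = interval M d (\<phi> a) (\<phi> b)" by blast
  with that ends E show ?thesis by blast
qed

lemma interval_segment:
  assumes "x \<in> M" "y \<in> M"
  shows "segment M d (interval M d x y) {x, y}"
proof -
  obtain s where s: "segment M d s {x, y}" using geodesic[OF assms] by blast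
  then obtain x' y' where "x' \<in> M" "y' \<in> M" "{x, y} = {x', y'}" "s = interval M d x' y'"
    by (rule segment_eq_interval)
  then have "s = interval M d x y"
    using interval_sym by (auto simp: doubleton_eq_iff)
  with s show ?thesis by simp
qed

lemma segment_from_endpoint:
  assumes "segment M d s E" "p \<in> E"
  obtains x where "p \<in> M" "x \<in> M" "s = interval M d p x"
  using segment_eq_interval[OF assms(1)] assms(2) interval_sym by (metis insertE singletonD)

lemma interval_point:
  assumes xy: "x \<in> M" "y \<in> M" and t: "0 \<le> t" "t \<le> d x y"
  obtains z where "z \<in> interval M d x y" "d x z = t"
proof -
  obtain s where "segment M d s {x, y}" using geodesic[OF xy] by blast
  then obtain a b \<phi> where ab: "a \<le> b" and \<phi>: "\<phi> \<in> {a..b} \<rightarrow> M"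
    and iso: "\<And>t u. \<lbrakk>t \<in> {a..b}; u \<in> {a..b}\<rbrakk> \<Longrightarrow> d (\<phi> t) (\<phi> u) = \<bar>t - u\<bar>"
    and E: "{x, y} = {\<phi> a, \<phi> b}"
    unfolding segment_def by blast
  have D: "d x y = b - a"
    using iso[of a b] iso[of b a] E ab by (auto simp: doubleton_eq_iff abs_of_nonpos)
  have t': "t \<le> b - a" using t D by simp
  then have ta: "a + t \<in> {a..b}" "b - t \<in> {a..b}"
    using t by (auto simp: le_diff_eq diff_le_eq add.commute)
  show ?thesis
  \<comment> \<open>The endpoints form an unordered pair, so the parametrization may run from
    \<open>y\<close> to \<open>x\<close>; the distance \<open>t\<close> is then measured back from
    \<open>b\<close>.\<close>
  proof (cases "x = \<phi> a \<and> y = \<phi> b")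
    case True
    have "d x (\<phi> (a + t)) = t" "d (\<phi> (a + t)) y = b - a - t"
      using True iso[of a "a + t"] iso[of "a + t" b] ta ab t
      by (auto simp: abs_of_nonpos algebra_simps)
    then show ?thesis
      using that[of "\<phi> (a + t)"] funcset_mem[OF \<phi> ta(1)] D by (simp add: interval_def)
  next
    case False
    then have xy': "x = \<phi> b" "y = \<phi> a" using E by (auto simp: doubleton_eq_iff)
    have "d x (\<phi> (b - t)) = t" "d (\<phi> (b - t)) y = b - a - t"
      using xy' iso[of b "b - t"] iso[of "b - t" a] ta ab t
      by (auto simp: algebra_simps)
    then show ?thesis
      using that[of "\<phi> (b - t)"] funcset_mem[OF \<phi> ta(2)] D by (simp add: interval_def)
  qed
qed

text \<open>A point z of [x, y] no farther from x than p equals the point of [x, p] at the same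
  distance from x, since both lie in [x, y]. The remaining points are treated in the same way from
  y.\<close>

lemma interval_split:
  assumes xy: "x \<in> M" "y \<in> M" and p: "p \<in> interval M d x y"
  shows "interval M d x y = interval M d p x \<union> interval M d p y"
proof
  have pM: "p \<in> M" and eq: "d x p + d p y = d x y" using p by (auto simp: interval_def)
  have p': "p \<in> interval M d y x" using p interval_sym[OF xy] by simp
  have aux: "z \<in> interval M d p x"
    if xy: "x \<in> M" "y \<in> M" and p: "p \<in> interval M d x y" and z: "z \<in> interval M d x y"
      and le: "d x z \<le> d x p" for x y z
  proof -
    have M: "z \<in> M" using z interval_subset by blast
    obtain w where w: "w \<in> interval M d x p" "d x w = d x z"
      using interval_point[OF xy(1) pM dist_nonneg[OF xy(1) M] le] by blast
    have "w \<in> interval M d x y" by (rule interval_trans[OF xy p w(1)])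
    then have "z = w" using interval_unique[OF xy z] w by simp
    with w interval_sym[OF xy(1) pM] show ?thesis by simp
  qed
  show "interval M d x y \<subseteq> interval M d p x \<union> interval M d p y"
  proof
    fix z assume z: "z \<in> interval M d x y"
    then have M: "z \<in> M" and zeq: "d x z + d z y = d x y" by (auto simp: interval_def)
    show "z \<in> interval M d p x \<union> interval M d p y"
    proof (cases "d x z \<le> d x p")
      case True
      then show ?thesis using aux[OF xy p z] by blast
    next
      case False
      \<comment> \<open>The distances of \<open>z\<close> to \<open>x\<close> and \<open>y\<close>
        have the same sum as those of \<open>p\<close>, so farther from \<open>x\<close> means
        nearer to \<open>y\<close>.\<close>
      have "d y z \<le> d y p"
      proof (rule ccontr)
        assume "\<not> d y z \<le> d y p"
        then have "d p y < d z y" using dist_sym xy M pM by auto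
        then have "d x p + d p y < d x z + d z y" using False by (simp add: add_strict_mono)
        with eq zeq show False by simp
      qed
      then show ?thesis
        using aux[OF xy(2,1) p'] z interval_sym[OF xy] by blast
    qed
  qed
  show "interval M d p x \<union> interval M d p y \<subseteq> interval M d x y"
    using interval_trans[OF xy p] interval_trans[OF xy(2,1) p'] interval_sym xy pM by blast
qed

section \<open>The axioms (T2) and (T3)\<close>

lemma endpoint_in_interval: "\<lbrakk>x \<in> M; y \<in> M\<rbrakk> \<Longrightarrow> x \<in> interval M d x y"
  using dist_zero_iff[of x x] by (simp add: interval_def)

text \<open>A path from x to y through c would pass z twice: adding the two interval equations and
  comparing with the triangle inequality through z gives 2 d(c, z) \<le> 0.\<close>

lemma eq_median_if_in_both_halves:
  assumes M: "x \<in> M" "y \<in> M" and c: "c \<in> interval M d x y"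
    and z: "z \<in> interval M d c x" "z \<in> interval M d c y"
  shows "z = c"
proof -
  have cM: "c \<in> M" and zM: "z \<in> M" using c z by (auto simp: interval_def)
  have eq: "d c z + d z x = d c x" "d c z + d z y = d c y" "d c x + d c y = d x y"
    using c z dist_sym[OF M(1) cM] by (auto simp: interval_def)
  have "d x y \<le> d z x + d z y"
    using dist_triangle[OF M(1) zM M(2)] dist_sym[OF M(1) zM] by simp
  then have "d c z + d z x + (d c z + d z y) \<le> d z x + d z y"
    using eq by simp
  then have "d c z + d c z \<le> 0" by (simp add: algebra_simps)
  then have "d c z = 0"
    using dist_nonneg[OF cM zM] by (metis add_nonneg_eq_0_iff add_nonneg_nonneg antisym)
  then show ?thesis using dist_zero_iff[OF cM zM] by simp
qed

lemma segment_Un: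
  assumes "segment M d s E" "segment M d t F" "s \<inter> t = {p}" "p \<in> E" "p \<in> F"
  shows "\<exists>D. segment M d (s \<union> t) D"
proof -
  obtain x where x: "p \<in> M" "x \<in> M" "s = interval M d p x"
    using segment_from_endpoint assms(1,4) by blast
  obtain y where y: "y \<in> M" "t = interval M d p y"
    using segment_from_endpoint assms(2,5) by blast
  obtain c where "c \<in> interval M d p x" "c \<in> interval M d x y" "c \<in> interval M d p y"
    using median[OF x(1,2) y(1)] by blast
  \<comment> \<open>The median lies in both segments, hence equals \<open>p\<close>.\<close>
  then have "p \<in> interval M d x y" using assms(3) x y by auto
  then have "s \<union> t = interval M d x y" using interval_split x y by simp
  then show ?thesis using interval_segment[OF x(2) y(1)] by auto
qed

lemma segment_Int:
  assumes "segment M d s E" "segment M d t F" "p \<in> E" "p \<in> F"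
  shows "\<exists>D. segment M d (s \<inter> t) D"
proof -
  obtain x where x: "p \<in> M" "x \<in> M" "s = interval M d p x"
    using segment_from_endpoint assms(1,3) by blast
  obtain y where y: "y \<in> M" "t = interval M d p y"
    using segment_from_endpoint assms(2,4) by blast
  obtain c where c: "c \<in> interval M d p x" "c \<in> interval M d x y" "c \<in> interval M d p y"
    using median[OF x(1,2) y(1)] by blast
  have cM: "c \<in> M" using c interval_subset by blast
  have "interval M d p x = interval M d p c \<union> interval M d c x"
    "interval M d p y = interval M d p c \<union> interval M d c y"
    using interval_split[OF x(1,2) c(1)] interval_split[OF x(1) y(1) c(3)]
      interval_sym[OF x(1) cM] by auto
  \<comment> \<open>Beyond the median the two segments share no point other than
    \<open>c\<close>.\<close>
  moreover have "interval M d c x \<inter> interval M d c y \<subseteq> interval M d p c"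
    using eq_median_if_in_both_halves[OF x(2) y(1) c(2)] endpoint_in_interval[OF cM x(1)]
      interval_sym[OF x(1) cM] by blast
  ultimately have "s \<inter> t = interval M d p c" using x y by auto
  then show ?thesis using interval_segment[OF x(1) cM] by auto
qed

lemma lambda_tree: "lambda_tree M d"
  unfolding lambda_tree_def using metric geodesic segment_Un segment_Int by blast

end


section \<open>Trees given by heights and meets\<close>

text \<open>An abstraction of prefixes of words: \<open>height\<close> is the length,
  \<open>meet\<close> the length of the common part and \<open>trunc\<close> the shortening to a
  given length. The meet is only a height; the branch point itself is
  \<open>trunc x (meet x y)\<close>.\<close>

locale meet_tree =
  fixes M :: "'p set"
    and height :: "'p \<Rightarrow> 'l::discrete_linordered_ab_group_add"
    and meet :: "'p \<Rightarrow> 'p \<Rightarrow> 'l"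
    and trunc :: "'p \<Rightarrow> 'l \<Rightarrow> 'p"
    and d :: "'p \<Rightarrow> 'p \<Rightarrow> 'l"
  assumes nonempty: "M \<noteq> {}"
    and meet_refl: "x \<in> M \<Longrightarrow> meet x x = height x"
    and meet_sym: "\<lbrakk>x \<in> M; y \<in> M\<rbrakk> \<Longrightarrow> meet x y = meet y x"
    and meet_nonneg: "\<lbrakk>x \<in> M; y \<in> M\<rbrakk> \<Longrightarrow> 0 \<le> meet x y"
    and meet_le: "\<lbrakk>x \<in> M; y \<in> M\<rbrakk> \<Longrightarrow> meet x y \<le> height x"
    and meet_ultra: "\<lbrakk>x \<in> M; y \<in> M; z \<in> M\<rbrakk> \<Longrightarrow> min (meet x y) (meet y z) \<le> meet x z"
    and meet_eq: "\<lbrakk>x \<in> M; y \<in> M; meet x y = height x; meet x y = height y\<rbrakk> \<Longrightarrow> x = y"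
    and trunc: "\<lbrakk>x \<in> M; 0 \<le> c; c \<le> height x\<rbrakk> \<Longrightarrow> trunc x c \<in> M \<and> height (trunc x c) = c"
    and meet_trunc: "\<lbrakk>x \<in> M; y \<in> M; 0 \<le> c; c \<le> height x\<rbrakk>
      \<Longrightarrow> meet (trunc x c) y = min c (meet x y)"
    and dist: "\<lbrakk>x \<in> M; y \<in> M\<rbrakk> \<Longrightarrow> d x y = height x + height y - (meet x y + meet x y)"
begin

section \<open>The metric\<close>

lemma meet_le': "\<lbrakk>x \<in> M; y \<in> M\<rbrakk> \<Longrightarrow> meet x y \<le> height y"
  using meet_le[of y x] meet_sym by simp

lemma dist_eq_sum: "\<lbrakk>x \<in> M; y \<in> M\<rbrakk> \<Longrightarrow> d x y = (height x - meet x y) + (height y - meet x y)"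
  by (simp add: dist algebra_simps)

text \<open>The smaller summand is at most \<open>meet x z\<close> by the ultrametric inequality,
  the larger at most \<open>height y\<close>. Doubled, this is the triangle inequality.\<close>

lemma meet_add_meet_le:
  assumes "x \<in> M" "y \<in> M" "z \<in> M"
  shows "meet x y + meet y z \<le> height y + meet x z"
proof (cases "meet x y \<le> meet y z")
  case True
  then show ?thesis
    using meet_ultra[OF assms] meet_le[OF assms(2,3)] add_mono by (fastforce simp: add.commute)
next
  case False
  then show ?thesis
    using meet_ultra[OF assms] meet_le'[OF assms(1,2)] add_mono by fastforce
qed

lemma metric: "lambda_metric M d"
proof -
  have "0 \<le> d x y" "d x y = 0 \<longleftrightarrow> x = y" "d x y = d y x" if "x \<in> M" "y \<in> M" for x y
  proof -
    note le = meet_le[OF that] meet_le'[OF that]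
    show "0 \<le> d x y" using le by (simp add: dist_eq_sum that)
    have "d x y = 0 \<longleftrightarrow> height x = meet x y \<and> height y = meet x y"
      using le by (simp add: dist_eq_sum that add_nonneg_eq_0_iff)
    then show "d x y = 0 \<longleftrightarrow> x = y" using meet_eq[OF that] meet_refl[OF that(1)] by metis
    show "d x y = d y x" using meet_sym[OF that] that by (simp add: dist add.commute)
  qed
  moreover have "d x z \<le> d x y + d y z" if "x \<in> M" "y \<in> M" "z \<in> M" for x y z
  proof -
    have "(meet x y + meet y z) + (meet x y + meet y z)
        \<le> (height y + meet x z) + (height y + meet x z)"
      using meet_add_meet_le[OF that] by (rule add_mono[OF _ meet_add_meet_le[OF that]])
    then have "(height x + height z) + ((meet x y + meet y z) + (meet x y + meet y z))
        \<le> (height x + height z) + ((height y + meet x z) + (height y + meet x z))"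
      by (rule add_left_mono)
    then show ?thesis using that by (simp add: dist algebra_simps)
  qed
  ultimately show ?thesis using nonempty unfolding lambda_metric_def by blast
qed

section \<open>Points between two given points\<close>

lemma interval_iff_meet_sum:
  assumes "x \<in> M" "y \<in> M" "z \<in> M"
  shows "z \<in> interval M d x y \<longleftrightarrow> height z + meet x y = meet x z + meet z y"
proof -
  have "z \<in> interval M d x y \<longleftrightarrow>
      (height z + meet x y) + (height z + meet x y) = (meet x z + meet z y) + (meet x z + meet z y)"
    using assms by (simp add: interval_def dist algebra_simps)
  then show ?thesis by (metis double_inject)
qed

text \<open>Here \<open>z\<close> is a truncation of \<open>x\<close> at or above the branching from
  \<open>y\<close>, so shortening \<open>x\<close> to \<open>z\<close> loses nothing of the common
  part with \<open>y\<close>.\<close>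

lemma meet_below:
  assumes "x \<in> M" "y \<in> M" "z \<in> M" "meet x z = height z" "meet x y \<le> height z"
  shows "meet z y = meet x y"
proof (rule antisym)
  show "meet z y \<le> meet x y"
    using meet_ultra[OF assms(1,3,2)] meet_le[OF assms(3,2)] assms(4) by simp
  show "meet x y \<le> meet z y"
    using meet_ultra[OF assms(3,1,2)] meet_sym[OF assms(1,3)] assms(4,5) by simp
qed

text \<open>In \<open>interval_iff_meet_sum\<close> the smaller meet on the right is at most
  \<open>meet x y\<close> by the ultrametric inequality and the larger at most
  \<open>height z\<close>; equality of the sums forces equality in both bounds.\<close>

lemma interval_iff:
  assumes M: "x \<in> M" "y \<in> M" "z \<in> M"
  shows "z \<in> interval M d x y \<longleftrightarrow> (meet x z = height z \<or> meet z y = height z) \<and> meet x y \<le> height z"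
proof
  assume "z \<in> interval M d x y"
  then have eq: "height z + meet x y = meet x z + meet z y"
    using interval_iff_meet_sum M by simp
  note le = meet_le'[OF M(1,3)] meet_le[OF M(3,2)] meet_ultra[OF M(1,3,2)]
  show "(meet x z = height z \<or> meet z y = height z) \<and> meet x y \<le> height z"
  proof (cases "meet x z \<le> meet z y")
    case True
    then have "meet x z \<le> meet x y" using le by simp
    then have "meet z y = height z \<and> meet x z = meet x y"
      using eq le by (metis add.commute add_less_le_mono add_le_less_mono less_irrefl order_le_less)
    then show ?thesis using le by auto
  next
    case False
    then have "meet z y \<le> meet x y" using le by simp
    then have "meet x z = height z \<and> meet z y = meet x y"
      using eq le by (metis add.commute add_less_le_mono add_le_less_mono less_irrefl order_le_less)
    then show ?thesis using le by auto
  qed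
next
  assume r: "(meet x z = height z \<or> meet z y = height z) \<and> meet x y \<le> height z"
  then consider "meet x z = height z" "meet z y = meet x y"
    | "meet z y = height z" "meet z x = meet y x"
    using meet_below[OF M] meet_below[OF M(2,1,3)] meet_sym M by metis
  then have "height z + meet x y = meet x z + meet z y"
    using meet_sym M by cases (simp_all add: add.commute)
  then show "z \<in> interval M d x y" using interval_iff_meet_sum M by simp
qed

lemma below_unique:
  assumes M: "u \<in> M" "z \<in> M" "w \<in> M"
    and "meet u z = height z" "meet u w = height w" "height z = height w"
  shows "z = w"
proof -
  have "height z \<le> meet z w"
    using meet_ultra[OF M(2,1,3)] meet_sym[OF M(1,2)] assms(4-6) by simp
  then show ?thesis
    using meet_eq[OF M(2,3)] meet_le[OF M(2,3)] assms(6) by simp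
qed

text \<open>On the branch of \<open>x\<close> the distance from \<open>x\<close> is height x -
  height z, on that of \<open>y\<close> it is height x + height z - 2 meet x y. So on one branch it
  determines the height, and \<open>below_unique\<close> applies.\<close>

lemma interval_unique:
  assumes M: "x \<in> M" "y \<in> M" and z: "z \<in> interval M d x y" and w: "w \<in> interval M d x y"
    and eq: "d x z = d x w"
  shows "z = w"
proof -
  have zM: "z \<in> M" and wM: "w \<in> M" using z w by (auto simp: interval_def)
  \<comment> \<open>On different branches, equal distances make the two heights add up to 2
    \<open>meet x y\<close>. As neither is below \<open>meet x y\<close>, both points are the branch
    point.\<close>
  have cross: "z = w"
    if zM: "z \<in> M" and wM: "w \<in> M" and le: "meet x y \<le> height z" "meet x y \<le> height w"
      and z: "meet x z = height z" and w: "meet y w = height w" and eq: "d x z = d x w" for z w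
  proof -
    have "meet x w = meet x y"
      using meet_below[OF M(2,1) wM w] meet_sym M le(2) wM by simp
    then have "height z + height w = meet x y + meet x y"
      using eq z M zM wM by (simp add: dist algebra_simps)
    then have "height z = meet x y" "height w = meet x y"
      using le by (metis add_less_le_mono add_le_less_mono less_irrefl order_le_less)+
    moreover have "meet y z = height z"
      using meet_below[OF M zM z le(1)] meet_sym[OF M(2) zM] \<open>height z = meet x y\<close> by simp
    ultimately show ?thesis using below_unique[OF M(2) zM wM _ w] by simp
  qed
  have le: "meet x y \<le> height z" "meet x y \<le> height w"
    and zc: "meet x z = height z \<or> meet y z = height z"
    and wc: "meet x w = height w \<or> meet y w = height w"
    using z w interval_iff[OF M zM] interval_iff[OF M wM] meet_sym M zM wM by auto
  consider "meet x z = height z" "meet x w = height w" | "meet x z = height z" "meet y w = height w"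
    | "meet y z = height z" "meet x w = height w" | "meet y z = height z" "meet y w = height w"
    using zc wc by blast
  then show ?thesis
  proof cases
    case 1
    then have "height z = height w" using eq M zM wM by (simp add: dist)
    with 1 show ?thesis using below_unique M(1) zM wM by blast
  next
    case 2
    then show ?thesis using cross zM wM le eq by blast
  next
    case 3
    then show ?thesis using cross[OF wM zM] le eq by simp
  next
    case 4
    then have "meet x z = meet x y" "meet x w = meet x y"
      using meet_below[OF M(2,1) zM] meet_below[OF M(2,1) wM] meet_sym M zM wM le by auto
    then have "height z = height w" using eq M zM wM by (simp add: dist)
    with 4 show ?thesis using below_unique M(2) zM wM by blast
  qed
qed

section \<open>Geodesics and medians\<close>

lemma meet_trunc_trunc:
  assumes "x \<in> M" "y \<in> M" "0 \<le> a" "a \<le> height x" "0 \<le> b" "b \<le> height y"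
  shows "meet (trunc x a) (trunc y b) = min a (min b (meet x y))"
  using assms trunc[of y b] meet_trunc[of x "trunc y b" a] meet_trunc[of y x b]
    meet_sym[of x "trunc y b"] meet_sym[of y x] by simp

lemma trunc_eqI:
  assumes M: "x \<in> M" "y \<in> M" and "meet x y = height y"
  shows "trunc x (height y) = y"
proof -
  have "0 \<le> height y" "height y \<le> height x"
    using assms meet_nonneg[OF M] meet_le[OF M] by auto
  then show ?thesis
    using trunc[OF M(1)] meet_trunc[OF M] meet_eq[of "trunc x (height y)" y] assms by simp
qed

lemma geodesic:
  assumes M: "x \<in> M" "y \<in> M"
  shows "\<exists>s. segment M d s {x, y}"
proof -
  \<comment> \<open>Parameter 0 is the branch point, of height \<open>c\<close>: negative parameters
    run along the branch of \<open>x\<close>, positive ones along that of \<open>y\<close>, and |t|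
    is the height above the branch point.\<close>
  define c where "c = meet x y"
  define a where "a = c - height x"
  define b where "b = height y - c"
  define \<phi> where "\<phi> t = (if t \<le> 0 then trunc x (c - t) else trunc y (c + t))" for t
  have \<phi>_nonpos: "t \<le> 0 \<Longrightarrow> \<phi> t = trunc x (c - t)"
    and \<phi>_pos: "0 < t \<Longrightarrow> \<phi> t = trunc y (c + t)" for t
    by (auto simp: \<phi>_def)
  have c: "0 \<le> c" "c \<le> height x" "c \<le> height y"
    using meet_nonneg meet_le meet_le' M by (auto simp: c_def)
  then have ab: "a \<le> 0" "0 \<le> b" by (auto simp: a_def b_def)
  have neg: "0 \<le> c - t" "c - t \<le> height x" "c \<le> c - t" if "a \<le> t" "t \<le> 0" for t
    using that c by (auto simp: a_def algebra_simps intro: order_trans)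
  have pos: "0 \<le> c + t" "c + t \<le> height y" "c \<le> c + t" if "0 < t" "t \<le> b" for t
    using that c by (auto simp: b_def algebra_simps intro: less_imp_le)
  have \<phi>M: "\<phi> t \<in> M" if "t \<in> {a..b}" for t
    using that neg[of t] pos[of t] trunc M by (auto simp: \<phi>_def)
  have ordered: "d (\<phi> t) (\<phi> u) = u - t" if t: "t \<in> {a..b}" and u: "u \<in> {a..b}" and "t \<le> u" for t u
  proof -
    consider "t \<le> 0" "u \<le> 0" | "t \<le> 0" "0 < u" | "0 < t" "0 < u"
      using \<open>t \<le> u\<close> by force
    then show ?thesis
    proof cases
      case 1
      have "meet (\<phi> t) (\<phi> u) = min (c - t) (min (c - u) (height x))"
        using 1 t u neg[of t] neg[of u] M by (simp add: \<phi>_nonpos \<phi>_pos meet_trunc_trunc meet_refl)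
      also have "\<dots> = c - u" using neg[of u] 1 u \<open>t \<le> u\<close> by simp
      finally show ?thesis
        using 1 t u neg[of t] neg[of u] trunc M \<phi>M[OF t] \<phi>M[OF u]
        by (simp add: dist) (simp add: \<phi>_nonpos \<phi>_pos trunc algebra_simps)
    next
      case 2
      have "meet (\<phi> t) (\<phi> u) = min (c - t) (min (c + u) c)"
        using 2 t u neg[of t] pos[of u] M by (simp add: \<phi>_nonpos \<phi>_pos meet_trunc_trunc c_def)
      also have "\<dots> = c" using neg[of t] pos[of u] 2 t u by simp
      finally show ?thesis
        using 2 t u neg[of t] pos[of u] trunc M \<phi>M[OF t] \<phi>M[OF u]
        by (simp add: dist) (simp add: \<phi>_nonpos \<phi>_pos trunc algebra_simps)
    next
      case 3
      have "meet (\<phi> t) (\<phi> u) = min (c + t) (min (c + u) (height y))"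
        using 3 t u pos[of t] pos[of u] M by (simp add: \<phi>_nonpos \<phi>_pos meet_trunc_trunc meet_refl)
      also have "\<dots> = c + t" using pos[of u] 3 u \<open>t \<le> u\<close> by simp
      finally show ?thesis
        using 3 t u pos[of t] pos[of u] trunc M \<phi>M[OF t] \<phi>M[OF u]
        by (simp add: dist) (simp add: \<phi>_nonpos \<phi>_pos trunc algebra_simps)
    qed
  qed
  have "d (\<phi> t) (\<phi> u) = \<bar>t - u\<bar>" if "t \<in> {a..b}" "u \<in> {a..b}" for t u
  proof (cases "t \<le> u")
    case True
    then show ?thesis using ordered that by (simp add: abs_of_nonpos)
  next
    case False
    then have "d (\<phi> u) (\<phi> t) = t - u" using ordered that by simp
    then show ?thesis
      using False metric \<phi>M[OF that(1)] \<phi>M[OF that(2)] by (simp add: lambda_metric_def)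
  qed
  moreover have "\<phi> a = x"
    using ab trunc_eqI[OF M(1) M(1)] meet_refl[OF M(1)] by (simp add: \<phi>_def a_def)
  \<comment> \<open>If \<open>b\<close> is 0, then \<open>y\<close> is itself the branch point and
    \<phi> reaches it as a truncation of \<open>x\<close>.\<close>
  moreover have "\<phi> b = y"
  proof (cases "b \<le> 0")
    case True
    then have "b = 0" "c = height y" using ab by (auto simp: b_def)
    then show ?thesis using trunc_eqI[OF M] by (simp add: \<phi>_def c_def)
  next
    case False
    then show ?thesis
      using trunc_eqI[OF M(2) M(2)] meet_refl[OF M(2)] by (simp add: \<phi>_def b_def)
  qed
  ultimately have "segment M d (\<phi> ` {a..b}) {x, y}"
    using ab \<phi>M unfolding segment_def by (intro exI[of _ a] exI[of _ b] exI[of _ \<phi>]) auto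
  then show ?thesis ..
qed

text \<open>The branch point of \<open>x\<close> and \<open>y\<close> is below both of them and, by
  maximality, at least as high as all three meets, so \<open>interval_iff\<close> applies to each
  pair.\<close>

lemma median_if_max:
  assumes M: "x \<in> M" "y \<in> M" "z \<in> M"
    and max: "meet y z \<le> meet x y" "meet x z \<le> meet x y"
  obtains c where "c \<in> interval M d x y" "c \<in> interval M d y z" "c \<in> interval M d x z"
proof -
  define c where "c = trunc x (meet x y)"
  note b = meet_nonneg[OF M(1,2)] meet_le[OF M(1,2)]
  have c: "c \<in> M" "height c = meet x y" using trunc[OF M(1) b] by (auto simp: c_def)
  have "meet x c = height c" "meet y c = height c"
    using meet_trunc[OF M(1) M(1) b] meet_trunc[OF M(1,2) b] meet_refl[OF M(1)] b c meet_sym M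
    by (auto simp: c_def[symmetric])
  then show ?thesis
    using that[of c] M c max by (simp add: interval_iff)
qed

sublocale median_space M d
proof
  show "lambda_metric M d" by (rule metric)
next
  fix x y assume "x \<in> M" "y \<in> M"
  then show "\<exists>s. segment M d s {x, y}" by (rule geodesic)
next
  fix x y z w
  assume "x \<in> M" "y \<in> M" "z \<in> interval M d x y" "w \<in> interval M d x y" "d x z = d x w"
  then show "z = w" by (rule interval_unique)
next
  fix x y z assume M: "x \<in> M" "y \<in> M" "z \<in> M"
  have sym: "interval M d x y = interval M d y x" if "x \<in> M" "y \<in> M" for x y
    using that metric unfolding interval_def lambda_metric_def by (auto simp: add.commute)
  \<comment> \<open>Whichever meet is the largest, a relabelling of the points reduces to
    \<open>median_if_max\<close>.\<close>
  consider "meet y z \<le> meet x y" "meet x z \<le> meet x y"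
    | "meet x y \<le> meet y z" "meet x z \<le> meet y z"
    | "meet x y \<le> meet x z" "meet y z \<le> meet x z"
    by (meson linear order_trans)
  then show "\<exists>c. c \<in> interval M d x y \<and> c \<in> interval M d y z \<and> c \<in> interval M d x z"
  proof cases
    case 1
    then show ?thesis using median_if_max[OF M] by metis
  next
    case 2
    then show ?thesis
      using median_if_max[OF M(2,3,1)] meet_sym sym M by metis
  next
    case 3
    then show ?thesis
      using median_if_max[OF M(1,3,2)] meet_sym sym M by metis
  qed
qed

end


section \<open>The tree of prefixes\<close>

locale CDR_group =
  fixes X :: "'x set"
    and G :: "('l::discrete_linordered_ab_group_add, 'x) lword set"
  assumes CDR_subgroup: "CDR_subgroup X G"
begin

section \<open>The equivalence relation and its classes\<close>

lemma len_nonneg_G: "f \<in> G \<Longrightarrow> 0 \<le> len f"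
  using CDR_subgroup CDR_subset_lwords[of X] unfolding CDR_subgroup_def
  by (metis len_nonneg subsetD)

lemma agree_upto_iff: "\<lbrakk>f \<in> G; g \<in> G\<rbrakk> \<Longrightarrow> agree_upto f g a \<longleftrightarrow> 0 \<le> a \<and> a \<le> cprod X f g"
  by (rule CDR_subgroup_agree_upto_iff[OF CDR_subgroup])

lemma cprod_nonneg: "\<lbrakk>f \<in> G; g \<in> G\<rbrakk> \<Longrightarrow> 0 \<le> cprod X f g"
  using agree_upto_iff[of f g 0] len_nonneg_G not_le[THEN iffD2, OF zero_less_one[where 'a='l]]
  by (simp add: agree_upto_def)

text \<open>In terms of agreement, transitivity of the relation is immediate, which it is not in
  terms of c(f, g).\<close>

lemma S_rel_iff:
  "((\<alpha>, f), (\<beta>, g)) \<in> S_rel X G \<longleftrightarrow> f \<in> G \<and> g \<in> G \<and> \<alpha> = \<beta> \<and> agree_upto f g \<alpha>"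
  using agree_upto_iff[of f g \<alpha>] by (auto simp: S_rel_def S_set_def agree_upto_def)

lemma equiv_S_rel: "equiv (S_set G) (S_rel X G)"
proof (rule equivI)
  show "S_rel X G \<subseteq> S_set G \<times> S_set G" by (auto simp: S_rel_def)
  show "refl_on (S_set G) (S_rel X G)"
    by (auto simp: refl_on_def S_rel_iff S_set_def agree_upto_refl)
  show "sym (S_rel X G)"
    by (auto simp: sym_def S_rel_iff agree_upto_sym)
  show "trans (S_rel X G)"
    unfolding trans_def by (clarsimp simp: S_rel_iff) (rule agree_upto_trans)
qed

lemma Gamma_pt_eq_iff:
  assumes "(\<alpha>, f) \<in> S_set G" "(\<beta>, g) \<in> S_set G"
  shows "Gamma_pt X G \<alpha> f = Gamma_pt X G \<beta> g \<longleftrightarrow> \<alpha> = \<beta> \<and> agree_upto f g \<alpha>"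
  unfolding Gamma_pt_def eq_equiv_class_iff[OF equiv_S_rel assms]
  using assms by (auto simp: S_rel_iff S_set_def)

lemma mem_Gamma_pt: "(\<alpha>, f) \<in> S_set G \<Longrightarrow>
    (\<beta>, g) \<in> Gamma_pt X G \<alpha> f \<longleftrightarrow> g \<in> G \<and> \<beta> = \<alpha> \<and> agree_upto f g \<alpha>"
  by (auto simp: Gamma_pt_def S_rel_iff S_set_def)

lemma Gamma_pt_in_Gamma: "(\<alpha>, f) \<in> S_set G \<Longrightarrow> Gamma_pt X G \<alpha> f \<in> Gamma X G"
  by (simp add: Gamma_def Gamma_pt_def quotientI)

definition meet_rep :: "'l \<Rightarrow> ('l, 'x) lword \<Rightarrow> 'l \<Rightarrow> ('l, 'x) lword \<Rightarrow> 'l"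
  where "meet_rep \<alpha> f \<beta> g = min (min \<alpha> \<beta>) (cprod X f g)"

text \<open>Lower bounds of \<open>meet_rep\<close> become agreement statements, so the ultrametric
  inequality reduces to transitivity of \<open>agree_upto\<close>.\<close>

lemma le_meet_rep_iff:
  assumes "f \<in> G" "g \<in> G" "0 \<le> a"
  shows "a \<le> meet_rep \<alpha> f \<beta> g \<longleftrightarrow> a \<le> \<alpha> \<and> a \<le> \<beta> \<and> agree_upto f g a"
  using assms agree_upto_iff[of f g a] by (simp add: meet_rep_def)

lemma meet_rep_nonneg: "\<lbrakk>(\<alpha>, f) \<in> S_set G; (\<beta>, g) \<in> S_set G\<rbrakk> \<Longrightarrow> 0 \<le> meet_rep \<alpha> f \<beta> g"
  using cprod_nonneg by (simp add: meet_rep_def S_set_def)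

lemma meet_rep_ultra:
  assumes "(\<alpha>, f) \<in> S_set G" "(\<beta>, g) \<in> S_set G" "(\<gamma>, h) \<in> S_set G"
  shows "min (meet_rep \<alpha> f \<beta> g) (meet_rep \<beta> g \<gamma> h) \<le> meet_rep \<alpha> f \<gamma> h"
proof -
  have G: "f \<in> G" "g \<in> G" "h \<in> G" using assms by (auto simp: S_set_def)
  define a where "a = min (meet_rep \<alpha> f \<beta> g) (meet_rep \<beta> g \<gamma> h)"
  have a: "0 \<le> a" using assms by (simp add: a_def meet_rep_nonneg)
  have "a \<le> meet_rep \<alpha> f \<beta> g" "a \<le> meet_rep \<beta> g \<gamma> h" by (auto simp: a_def)
  then have "a \<le> meet_rep \<alpha> f \<gamma> h"
    using agree_upto_trans[of f g a h] a G by (simp add: le_meet_rep_iff)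
  then show ?thesis by (simp add: a_def)
qed

lemma meet_rep_sym: "\<lbrakk>f \<in> G; g \<in> G\<rbrakk> \<Longrightarrow> meet_rep \<alpha> f \<beta> g = meet_rep \<beta> g \<alpha> f"
  unfolding meet_rep_def
  using agree_upto_iff[of f g] agree_upto_iff[of g f] agree_upto_sym[of f g] cprod_nonneg[of f g]
    cprod_nonneg[of g f]
  by (metis antisym min.commute order_refl)

lemma meet_rep_refl: "(\<alpha>, f) \<in> S_set G \<Longrightarrow> meet_rep \<alpha> f \<alpha> f = \<alpha>"
  using agree_upto_iff[of f f \<alpha>] by (auto simp: meet_rep_def S_set_def agree_upto_refl)

text \<open>The common part never exceeds \<alpha>, so agreement of \<open>f\<close> and
  \<open>f'\<close> up to \<alpha> transfers it; the converse inequality follows by exchanging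
  \<open>f\<close> and \<open>f'\<close>.\<close>

lemma meet_rep_cong:
  assumes "f \<in> G" "f' \<in> G" "g \<in> G" "agree_upto f f' \<alpha>" "0 \<le> \<beta>"
  shows "meet_rep \<alpha> f \<beta> g = meet_rep \<alpha> f' \<beta> g"
proof -
  have le: "meet_rep \<alpha> f \<beta> g \<le> meet_rep \<alpha> f' \<beta> g"
    if "f \<in> G" "f' \<in> G" "agree_upto f f' \<alpha>" for f f'
  proof -
    have a: "0 \<le> meet_rep \<alpha> f \<beta> g"
      using that assms cprod_nonneg by (simp add: meet_rep_def agree_upto_def)
    have "meet_rep \<alpha> f \<beta> g \<le> \<alpha> \<and> meet_rep \<alpha> f \<beta> g \<le> \<beta> \<and> agree_upto f g (meet_rep \<alpha> f \<beta> g)"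
      using le_meet_rep_iff[OF that(1) assms(3) a] by blast
    then show ?thesis
      using le_meet_rep_iff[OF that(2) assms(3) a] agree_upto_mono[OF that(3) a]
        agree_upto_sym agree_upto_trans by blast
  qed
  show ?thesis
    using le[OF assms(1,2,4)] le[OF assms(2,1)] assms(4) agree_upto_sym by (metis antisym)
qed

section \<open>The distance on classes\<close>

lemma Gamma_dist_rep_eq:
  "Gamma_dist_rep X \<alpha> f \<beta> g = \<alpha> + \<beta> - (meet_rep \<alpha> f \<beta> g + meet_rep \<alpha> f \<beta> g)"
  by (simp add: Gamma_dist_rep_def meet_rep_def Let_def)

text \<open>Existence of the common value comes from replacing one representative at a time, using
  symmetry for the second. Uniqueness holds because both classes are nonempty.\<close>

lemma Gamma_dist_pt:
  assumes f: "(\<alpha>, f) \<in> S_set G" and g: "(\<beta>, g) \<in> S_set G"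
  shows "Gamma_dist X (Gamma_pt X G \<alpha> f) (Gamma_pt X G \<beta> g) = Gamma_dist_rep X \<alpha> f \<beta> g"
  unfolding Gamma_dist_def
proof (rule the_equality)
  have G: "f \<in> G" "g \<in> G" "0 \<le> \<alpha>" "0 \<le> \<beta>" using f g by (auto simp: S_set_def)
  have "Gamma_dist_rep X \<alpha> f \<beta> g = Gamma_dist_rep X \<alpha> f' \<beta> g'"
    if "f' \<in> G" "agree_upto f f' \<alpha>" "g' \<in> G" "agree_upto g g' \<beta>" for f' g'
    using meet_rep_cong[of f f' g \<alpha> \<beta>] meet_rep_cong[of g g' f' \<beta> \<alpha>] that G
      meet_rep_sym[of f' g \<alpha> \<beta>] meet_rep_sym[of f' g' \<alpha> \<beta>]
    by (simp add: Gamma_dist_rep_eq)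
  then show "\<forall>(\<alpha>', f')\<in>Gamma_pt X G \<alpha> f. \<forall>(\<beta>', g')\<in>Gamma_pt X G \<beta> g.
      Gamma_dist_rep X \<alpha> f \<beta> g = Gamma_dist_rep X \<alpha>' f' \<beta>' g'"
    using mem_Gamma_pt[OF f] mem_Gamma_pt[OF g] by auto
next
  fix r
  assume r: "\<forall>(\<alpha>', f')\<in>Gamma_pt X G \<alpha> f. \<forall>(\<beta>', g')\<in>Gamma_pt X G \<beta> g.
      r = Gamma_dist_rep X \<alpha>' f' \<beta>' g'"
  have "(\<alpha>, f) \<in> Gamma_pt X G \<alpha> f" "(\<beta>, g) \<in> Gamma_pt X G \<beta> g"
    using mem_Gamma_pt f g by (auto simp: S_set_def agree_upto_refl)
  with r show "r = Gamma_dist_rep X \<alpha> f \<beta> g" by blast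
qed

text \<open>A choice of representative for each class. Its height is determined by the class, its
  word only up to that height.\<close>

definition rep :: "('l \<times> ('l, 'x) lword) set \<Rightarrow> 'l \<times> ('l, 'x) lword"
  where "rep P = (SOME p. p \<in> S_set G \<and> P = Gamma_pt X G (fst p) (snd p))"

definition height :: "('l \<times> ('l, 'x) lword) set \<Rightarrow> 'l" where "height P = fst (rep P)"

definition word :: "('l \<times> ('l, 'x) lword) set \<Rightarrow> ('l, 'x) lword" where "word P = snd (rep P)"

lemma rep:
  assumes "P \<in> Gamma X G"
  shows "(height P, word P) \<in> S_set G" "Gamma_pt X G (height P) (word P) = P"
proof -
  have "\<exists>p. p \<in> S_set G \<and> P = Gamma_pt X G (fst p) (snd p)"
    using assms by (auto simp: Gamma_def Gamma_pt_def elim!: quotientE)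
  from someI_ex[OF this]
  show "(height P, word P) \<in> S_set G" "Gamma_pt X G (height P) (word P) = P"
    unfolding height_def word_def rep_def by auto
qed

lemma rep_Gamma_pt:
  assumes "(\<alpha>, f) \<in> S_set G"
  shows "height (Gamma_pt X G \<alpha> f) = \<alpha>" "agree_upto (word (Gamma_pt X G \<alpha> f)) f \<alpha>"
  using rep[OF Gamma_pt_in_Gamma[OF assms]] Gamma_pt_eq_iff[OF _ assms] by metis+

definition meet :: "('l \<times> ('l, 'x) lword) set \<Rightarrow> ('l \<times> ('l, 'x) lword) set \<Rightarrow> 'l"
  where "meet P Q = meet_rep (height P) (word P) (height Q) (word Q)"

sublocale meet_tree "Gamma X G" height meet "\<lambda>P \<gamma>. Gamma_pt X G \<gamma> (word P)" "Gamma_dist X"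
proof
  have "(0, empty_word) \<in> S_set G"
    using CDR_subgroup by (simp add: CDR_subgroup_def S_set_def empty_word_def)
  then show "Gamma X G \<noteq> {}" using Gamma_pt_in_Gamma by blast
next
  fix P assume P: "P \<in> Gamma X G"
  then show "meet P P = height P" by (simp add: meet_def meet_rep_refl rep)
  fix c assume c: "0 \<le> c" "c \<le> height P"
  then have S: "(c, word P) \<in> S_set G" using rep(1)[OF P] by (auto simp: S_set_def)
  show "Gamma_pt X G c (word P) \<in> Gamma X G \<and> height (Gamma_pt X G c (word P)) = c"
    using S Gamma_pt_in_Gamma rep_Gamma_pt by blast
  fix Q assume Q: "Q \<in> Gamma X G"
  define P' where "P' = Gamma_pt X G c (word P)"
  have P': "P' \<in> Gamma X G" using Gamma_pt_in_Gamma[OF S] by (simp add: P'_def)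
  have "meet P' Q = meet_rep c (word P') (height Q) (word Q)"
    using rep_Gamma_pt[OF S] by (simp add: meet_def P'_def)
  \<comment> \<open>The word chosen for P' may differ from \<open>word P\<close>, but the two agree
    up to \<open>c\<close>.\<close>
  also have "\<dots> = meet_rep c (word P) (height Q) (word Q)"
    using rep(1)[OF P] rep(1)[OF P'] rep(1)[OF Q] rep_Gamma_pt(2)[OF S]
    by (intro meet_rep_cong) (auto simp: S_set_def P'_def)
  also have "\<dots> = min c (meet P Q)"
    using c by (simp add: meet_def meet_rep_def min.assoc[symmetric] min.absorb1)
  finally show "meet (Gamma_pt X G c (word P)) Q = min c (meet P Q)" by (simp add: P'_def)
next
  fix P Q assume PQ: "P \<in> Gamma X G" "Q \<in> Gamma X G"
  note S = rep(1)[OF PQ(1)] rep(1)[OF PQ(2)]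
  have G: "word P \<in> G" "word Q \<in> G" using S by (auto simp: S_set_def)
  show "meet P Q = meet Q P" using G by (simp add: meet_def meet_rep_sym)
  show "0 \<le> meet P Q" using S by (simp add: meet_def meet_rep_nonneg)
  show "meet P Q \<le> height P" by (simp add: meet_def meet_rep_def min.coboundedI1)
  show "Gamma_dist X P Q = height P + height Q - (meet P Q + meet P Q)"
    using Gamma_dist_pt[OF S] rep(2) PQ by (simp add: meet_def Gamma_dist_rep_eq)
  show "P = Q" if "meet P Q = height P" "meet P Q = height Q"
  proof -
    have "agree_upto (word P) (word Q) (height P)"
      using le_meet_rep_iff[OF G, of "height P" "height P" "height Q"] that S
      by (simp add: meet_def S_set_def)
    then show ?thesis
      using Gamma_pt_eq_iff[OF S] that rep(2)[OF PQ(1)] rep(2)[OF PQ(2)] by simp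
  qed
next
  fix P Q R assume "P \<in> Gamma X G" "Q \<in> Gamma X G" "R \<in> Gamma X G"
  then show "min (meet P Q) (meet Q R) \<le> meet P R"
    using meet_rep_ultra rep(1) by (simp add: meet_def)
qed

end

text \<open>Neither the equivalence property nor independence of representatives is built into the
  definitions, so both are asserted next to the tree property.\<close>

theorem proposition1:
  fixes X :: "'x set"
    and G :: "('l::discrete_linordered_ab_group_add, 'x) lword set"
  assumes "CDR_subgroup X G"
  shows "equiv (S_set G) (S_rel X G) \<and>
    (\<forall>(\<alpha>, f)\<in>S_set G. \<forall>(\<beta>, g)\<in>S_set G.
       Gamma_dist X (Gamma_pt X G \<alpha> f) (Gamma_pt X G \<beta> g)
         = (let m = min (min \<alpha> \<beta>) (cprod X f g) in \<alpha> + \<beta> - (m + m))) \<and>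
    lambda_tree (Gamma X G) (Gamma_dist X)"
proof -
  interpret CDR_group X G by unfold_locales (rule assms)
  show ?thesis
    using equiv_S_rel Gamma_dist_pt lambda_tree by (auto simp: Gamma_dist_rep_def)
qed

end
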